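(* Let $q=2^e$ with $e\ge 1$. Then for every $n\ge 0$, $$c_{n,0}^{(q)}=1,\qquad c_{n,r}^{(q)}=0\quad\text{if } r>\left\lfloor\frac n2\right\rfloor,$$ and for $1\le r\le\lfloor n/2\rfloor$, $$c_{n,r}^{(q)}=q^r c_{n-1,r}^{(q)}+\bigl(q^{n-r}-q^{r-1}\bigr)c_{n-1,r-1}^{(q)}.$$ Consequently, $b_{n,r}^{(q)}=c_{n,r}^{(q)}$ for all $n$ and $r$.
   Context: For a finite field $\mathbb F_q$, $b_{n,r}^{(q)}$ is the number of $n\times n$ upper triangular matrices $X$ over $\mathbb F_q$ with $X^2=0$ and $\operatorname{rank}X=r$, and $c_{n,r}^{(q)}$ is the number of $n\times n$ upper triangular matrices $U$ over $\mathbb F_q$ with $U^TU=0$ and $\operatorname{rank}U=r$. Conventions: $b_{0,0}^{(q)}=c_{0,0}^{(q)}=1$, and all out-of-range values are zero. *)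

theory Defs
  imports "Jordan_Normal_Form.DL_Rank"
begin

text \<open>
  The type \<open>'a\<close> plays the role of the finite field with q elements, where q = \<open>CARD('a)\<close>;
  it is passed as an \<open>itself\<close> argument because the counts below do not otherwise mention it.
\<close>

definition square_zero_count :: "'a::{field,finite} itself \<Rightarrow> nat \<Rightarrow> nat \<Rightarrow> nat" where
  "square_zero_count _ n r =
     card {X :: 'a mat. X \<in> carrier_mat n n \<and> upper_triangular X \<and>
                        X * X = 0\<^sub>m n n \<and> vec_space.rank n X = r}"

definition gram_zero_count :: "'a::{field,finite} itself \<Rightarrow> nat \<Rightarrow> nat \<Rightarrow> nat" where
  "gram_zero_count _ n r =
     card {U :: 'a mat. U \<in> carrier_mat n n \<and> upper_triangular U \<and>
                        transpose_mat U * U = 0\<^sub>m n n \<and> vec_space.rank n U = r}"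

text \<open>
  The sets being counted are finite, so \<open>card\<close> is a genuine count, and the conventions
  (value 1 at n = r = 0, value 0 out of range) hold automatically.
\<close>

lemma finite_carrier_mat: "finite (carrier_mat n m :: 'a::finite mat set)"
proof (rule finite_subset)
  let ?F = "PiE ({..<n} \<times> {..<m}) (\<lambda>_. UNIV :: 'a set)"
  show "carrier_mat n m \<subseteq> mat n m ` ?F"
  proof
    fix A :: "'a mat" assume "A \<in> carrier_mat n m"
    then have "A = mat n m (restrict (\<lambda>ij. A $$ ij) ({..<n} \<times> {..<m}))"
      by (intro eq_matI) auto
    moreover have "restrict (\<lambda>ij. A $$ ij) ({..<n} \<times> {..<m}) \<in> ?F" by simp
    ultimately show "A \<in> mat n m ` ?F" by (metis image_eqI)
  qed
  show "finite (mat n m ` ?F)" by (intro finite_imageI finite_PiE) auto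
qed

lemma rank_le_dim:
  assumes "A \<in> carrier_mat n n"
  shows "vec_space.rank n (A :: 'a::field mat) \<le> n"
  by (rule vec_space.rank_le_nc[OF assms])

lemma carrier_mat_0: "carrier_mat 0 0 = {0\<^sub>m 0 0}"
  by (auto intro!: eq_matI)

lemma square_zero_count_0_0: "square_zero_count TYPE('a::{field,finite}) 0 0 = 1"
proof -
  have "{X :: 'a mat. X \<in> carrier_mat 0 0 \<and> upper_triangular X \<and>
          X * X = 0\<^sub>m 0 0 \<and> vec_space.rank 0 X = 0} = {0\<^sub>m 0 0}"
    using rank_le_dim[of "0\<^sub>m 0 0 :: 'a mat" 0] by (auto simp: carrier_mat_0)
  then show ?thesis by (simp add: square_zero_count_def)
qed

lemma gram_zero_count_0_0: "gram_zero_count TYPE('a::{field,finite}) 0 0 = 1"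
proof -
  have "{U :: 'a mat. U \<in> carrier_mat 0 0 \<and> upper_triangular U \<and>
          transpose_mat U * U = 0\<^sub>m 0 0 \<and> vec_space.rank 0 U = 0} = {0\<^sub>m 0 0}"
    using rank_le_dim[of "0\<^sub>m 0 0 :: 'a mat" 0] by (auto simp: carrier_mat_0)
  then show ?thesis by (simp add: gram_zero_count_def)
qed

lemma square_zero_count_out_of_range:
  "r > n \<Longrightarrow> square_zero_count TYPE('a::{field,finite}) n r = 0"
  unfolding square_zero_count_def by (rule card_eq_0_iff[THEN iffD2]) (use rank_le_dim leD in blast)

lemma gram_zero_count_out_of_range:
  "r > n \<Longrightarrow> gram_zero_count TYPE('a::{field,finite}) n r = 0"
  unfolding gram_zero_count_def by (rule card_eq_0_iff[THEN iffD2]) (use rank_le_dim leD in blast)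

end

theory Submission
  imports Defs "Berlekamp_Zassenhaus.Berlekamp_Type_Based" "HOL-Number_Theory.Residues"
begin

text \<open>
  Both families of matrices are built one border at a time, and for both the number of borders
  that keep or raise the rank is the same function of the size and the rank; this forces the same
  recurrence and hence the same counts.

  Write an upper triangular matrix of size n + 1 as a matrix Y of size n bordered by a last column
  v, a last row of zeros and a corner entry x. The bordered matrix squares to zero iff \<open>Y\<^sup>2 = 0\<close>,
  \<open>Y v = 0\<close> and \<open>x = 0\<close>. It satisfies \<open>U\<^sup>T U = 0\<close> iff \<open>Y\<^sup>T Y = 0\<close>,
  \<open>Y\<^sup>T v = 0\<close> and \<open>v \<bullet> v + x\<^sup>2 = 0\<close>. In characteristic two a sum of squares is
  the square of the sum, so the last equation says that x is the sum of the entries of v. In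
  both cases, therefore, Y belongs to the same family, v ranges over a subspace K of size
  \<open>q ^ (n - rank Y)\<close> (the kernel of Y or of its transpose), and v determines x.

  The defining equation of the family also says that the column space C of Y lies in K. If v is
  in C then x = 0: in the second family \<open>v \<bullet> v = 0\<close> for such v, as C is isotropic. So the
  border raises the rank by one exactly when v lies outside C. With s = rank Y this gives
  \<open>q ^ s\<close> borders that keep the rank and \<open>q ^ (n - s) - q ^ s\<close> that raise it
  (\<open>rank_border\<close> and the locale \<open>bordered_family\<close>). The vanishing for large rank follows from
  the recurrence, because the second number is zero when \<open>2 s = n\<close>.

  The linear algebra is done by counting. A column space has \<open>q ^ rank\<close> elements
  (\<open>card_col_space\<close>), so ranks can be read off from cardinalities; rank-nullity becomes a count of
  fibres; and a matrix and its transpose have kernels of equal size (\<open>card_kernel_transpose\<close>)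
  by double counting the pairs (x, y) with \<open>y \<bullet> A x = 0\<close>.
\<close>

section \<open>Ranks and kernels by counting vectors\<close>

text \<open>
  Coordinates with respect to a basis are unique, so vectors correspond to functions from the
  basis to the scalars.
\<close>

lemma (in vectorspace) card_carrier_eq_power_dim:
  assumes "fin_dim" "finite (carrier K)"
  shows "card (carrier V) = card (carrier K) ^ dim"
proof -
  obtain B where B: "finite B" "basis B" using finite_basis_exists assms(1) by blast
  have BV: "B \<subseteq> carrier V" using B(2) by (simp add: basis_def)
  have unique: "\<exists>!a. a \<in> B \<rightarrow>\<^sub>E carrier K \<and> lincomb a B = v" if "v \<in> carrier V" for v
    using basis_criterion[OF B(1) BV] B(2) that by blast
  have closed: "lincomb a B \<in> carrier V" if "a \<in> B \<rightarrow>\<^sub>E carrier K" for a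
    using that B(1) BV by (intro lincomb_closed) (auto simp: PiE_def)
  have "bij_betw (\<lambda>a. lincomb a B) (B \<rightarrow>\<^sub>E carrier K) (carrier V)"
    unfolding bij_betw_def
  proof
    show "inj_on (\<lambda>a. lincomb a B) (B \<rightarrow>\<^sub>E carrier K)"
      by (rule inj_onI) (use unique closed in blast)
    show "(\<lambda>a. lincomb a B) ` (B \<rightarrow>\<^sub>E carrier K) = carrier V"
      using unique closed by blast
  qed
  then have "card (carrier V) = card (B \<rightarrow>\<^sub>E carrier K)"
    by (simp add: bij_betw_same_card)
  then show ?thesis using B by (simp add: card_PiE dim_basis)
qed

text \<open>
  This turns every statement about ranks below into one about cardinalities.
\<close>

lemma card_col_space:
  fixes A :: "'a::{field,finite} mat"
  assumes "A \<in> carrier_mat n nc"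
  shows "card (vec_space.col_space n A) = CARD('a) ^ vec_space.rank n A"
proof -
  interpret vec_space "TYPE('a)" n .
  have cols: "set (cols A) \<subseteq> carrier_vec n" using cols_dim assms by blast
  interpret W: vectorspace class_ring "span_vs (set (cols A))"
    using cols span_is_subspace subspace_is_vs by auto
  have "W.fin_dim" using fin_dim_span_cols assms by blast
  then show ?thesis
    using W.card_carrier_eq_power_dim
    by (simp add: col_space_def rank_def class_ring_simps)
qed

lemma col_space_eq_image:
  fixes A :: "'a::field mat"
  assumes "A \<in> carrier_mat n nc"
  shows "vec_space.col_space n A = (\<lambda>w. A *\<^sub>v w) ` carrier_vec nc"
  using vec_space.col_space_eq[OF assms] assms by auto

text \<open>
  Rank-nullity in multiplicative form: the fibres of \<open>w \<mapsto> A w\<close> are the translates of the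
  kernel, indexed by the column space.
\<close>

lemma card_kernel_mult_card_col_space:
  fixes A :: "'a::{field,finite} mat"
  assumes A: "A \<in> carrier_mat n nc"
  shows "card (mat_kernel A) * card (vec_space.col_space n A) = CARD('a) ^ nc"
proof -
  have fibre: "card {w. w \<in> carrier_vec nc \<and> A *\<^sub>v w = b} = card (mat_kernel A)"
    if b: "b \<in> (\<lambda>w. A *\<^sub>v w) ` carrier_vec nc" for b
  proof -
    obtain u where u: "u \<in> carrier_vec nc" "b = A *\<^sub>v u" using b by blast
    have "bij_betw (\<lambda>w. w - u) {w. w \<in> carrier_vec nc \<and> A *\<^sub>v w = b} (mat_kernel A)"
      by (rule bij_betw_byWitness[where f' = "\<lambda>w. w + u"])
         (use A u in \<open>auto simp: mat_kernel_def mult_minus_distrib_mat_vec[of _ n nc]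
            mult_add_distrib_mat_vec[of _ n nc] left_zero_vec[of _ n]\<close>)
    then show ?thesis by (rule bij_betw_same_card)
  qed
  have "CARD('a) ^ nc = (\<Sum>w\<in>(carrier_vec nc :: 'a vec set). 1)"
    by (simp add: card_carrier_vec)
  also have "\<dots> = (\<Sum>b\<in>(\<lambda>w. A *\<^sub>v w) ` carrier_vec nc. card {w. w \<in> carrier_vec nc \<and> A *\<^sub>v w = b})"
    by (subst sum.image_gen[where g = "\<lambda>w. A *\<^sub>v w"]) auto
  also have "\<dots> = card (mat_kernel A) * card ((\<lambda>w. A *\<^sub>v w) ` carrier_vec nc)"
    by (simp add: fibre)
  finally show ?thesis by (simp add: col_space_eq_image[OF A])
qed

lemma card_kernel:
  fixes A :: "'a::{field,finite} mat"
  assumes A: "A \<in> carrier_mat n n"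
  shows "card (mat_kernel A) = CARD('a) ^ (n - vec_space.rank n A)"
proof -
  have "card (mat_kernel A) * CARD('a) ^ vec_space.rank n A
      = CARD('a) ^ (n - vec_space.rank n A) * CARD('a) ^ vec_space.rank n A"
    using card_kernel_mult_card_col_space[OF A] card_col_space[OF A] rank_le_dim[OF A]
    by (simp flip: power_add)
  then show ?thesis by simp
qed

lemma one_less_card_field: "1 < CARD('a::{field,finite})"
proof -
  have "card {0, 1 :: 'a} \<le> CARD('a)" by (rule card_mono) auto
  then show ?thesis by simp
qed

text \<open>
  For nonzero w the complement is the kernel of the one-row matrix w, whose column space is the
  whole line. Multiplying by \<open>CARD('a)\<close> avoids the exponent n - 1.
\<close>

lemma card_orthogonal_complement:
  fixes w :: "'a::{field,finite} vec"
  assumes w: "w \<in> carrier_vec n"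
  shows "CARD('a) * card {y \<in> carrier_vec n. y \<bullet> w = 0}
           = CARD('a) ^ n * (if w = 0\<^sub>v n then CARD('a) else 1)"
proof (cases "w = 0\<^sub>v n")
  case True
  then have "{y \<in> carrier_vec n. y \<bullet> w = 0} = carrier_vec n" by auto
  then show ?thesis using True by (simp add: card_carrier_vec)
next
  case False
  define R where "R = mat_of_rows n [w]"
  have R: "R \<in> carrier_mat 1 n" by (simp add: R_def mat_of_rows_def)
  have Rmult: "R *\<^sub>v y = vec 1 (\<lambda>_. y \<bullet> w)" if "y \<in> carrier_vec n" for y
    using that w R by (intro eq_vecI) (auto simp: R_def comm_scalar_prod[of w n])
  have "R *\<^sub>v y = 0\<^sub>v 1 \<longleftrightarrow> y \<bullet> w = 0" if y: "y \<in> carrier_vec n" for y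
    unfolding Rmult[OF y] by (auto simp: vec_eq_iff)
  then have ker: "mat_kernel R = {y \<in> carrier_vec n. y \<bullet> w = 0}"
    unfolding mat_kernel[OF R] by blast
  obtain i where i: "i < n" "w $ i \<noteq> 0"
    using False w by (metis eq_vecI carrier_vecD index_zero_vec)
  have "vec_space.col_space 1 R = carrier_vec 1"
  proof
    show "vec_space.col_space 1 R \<subseteq> carrier_vec 1"
      unfolding col_space_eq_image[OF R] using mult_mat_vec_carrier[OF R] by blast
    show "carrier_vec 1 \<subseteq> vec_space.col_space 1 R"
    proof
      fix b :: "'a vec" assume b: "b \<in> carrier_vec 1"
      define y where "y = (b $ 0 / w $ i) \<cdot>\<^sub>v unit_vec n i"
      have y: "y \<in> carrier_vec n" by (simp add: y_def)
      have "y \<bullet> w = b $ 0" using i w by (simp add: y_def)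
      then have "R *\<^sub>v y = b" using b by (intro eq_vecI) (auto simp: Rmult[OF y])
      then show "b \<in> vec_space.col_space 1 R"
        unfolding col_space_eq_image[OF R] using y by blast
    qed
  qed
  then show ?thesis
    using card_kernel_mult_card_col_space[OF R] False
    by (simp add: ker card_carrier_vec mult.commute)
qed

text \<open>
  Count the pairs (x, y) with \<open>y \<bullet> A x = 0\<close>. For a fixed x every y qualifies if x is in the
  kernel, and one in q of them otherwise; so the number of pairs determines the size of the
  kernel. Since \<open>y \<bullet> A\<^sup>T x = x \<bullet> A y\<close>, the transpose has the same number of pairs.
\<close>

lemma card_kernel_transpose:
  fixes A :: "'a::{field,finite} mat"
  assumes A: "A \<in> carrier_mat n n"
  shows "card (mat_kernel A\<^sup>T) = card (mat_kernel A)"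
proof -
  let ?C = "carrier_vec n :: 'a vec set" and ?q = "CARD('a)"
  have q: "?q > 1" by (rule one_less_card_field)
  have count: "?q * (\<Sum>x\<in>?C. card {y \<in> ?C. y \<bullet> (M *\<^sub>v x) = 0})
      = ?q ^ n * ?q ^ n + ?q ^ n * (?q - 1) * card (mat_kernel M)"
    if M: "M \<in> carrier_mat n n" for M :: "'a mat"
  proof -
    have "?q * (\<Sum>x\<in>?C. card {y \<in> ?C. y \<bullet> (M *\<^sub>v x) = 0})
        = (\<Sum>x\<in>?C. ?q ^ n + (if x \<in> mat_kernel M then ?q ^ n * (?q - 1) else 0))"
      unfolding sum_distrib_left
    proof (rule sum.cong[OF refl])
      fix x assume x: "x \<in> ?C"
      then have "M *\<^sub>v x \<in> ?C" using M by auto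
      from card_orthogonal_complement[OF this]
      show "?q * card {y \<in> ?C. y \<bullet> (M *\<^sub>v x) = 0}
        = ?q ^ n + (if x \<in> mat_kernel M then ?q ^ n * (?q - 1) else 0)"
        using x M q by (auto simp: mat_kernel_def algebra_simps)
    qed
    also have "\<dots> = ?q ^ n * ?q ^ n + ?q ^ n * (?q - 1) * card (?C \<inter> mat_kernel M)"
      by (simp add: sum.distrib card_carrier_vec sum.inter_restrict[symmetric])
    also have "?C \<inter> mat_kernel M = mat_kernel M" using M by (auto simp: mat_kernel_def)
    finally show ?thesis .
  qed
  have swap: "y \<bullet> (A\<^sup>T *\<^sub>v x) = x \<bullet> (A *\<^sub>v y)" if "x \<in> ?C" "y \<in> ?C" for x y
    using transpose_vec_mult_scalar[OF A that(2,1)] comm_scalar_prod[of y n "A\<^sup>T *\<^sub>v x"] A that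
    by simp
  have "(\<Sum>x\<in>?C. card {y \<in> ?C. y \<bullet> (A\<^sup>T *\<^sub>v x) = 0}) = (\<Sum>x\<in>?C. card {y \<in> ?C. x \<bullet> (A *\<^sub>v y) = 0})"
    by (intro sum.cong refl arg_cong[of _ _ card] Collect_cong conj_cong) (simp add: swap)
  also have "\<dots> = (\<Sum>y\<in>?C. card {x \<in> ?C. x \<bullet> (A *\<^sub>v y) = 0})"
    by (rule sum_multicount_gen) auto
  finally have sums: "(\<Sum>x\<in>?C. card {y \<in> ?C. y \<bullet> (A\<^sup>T *\<^sub>v x) = 0})
      = (\<Sum>x\<in>?C. card {y \<in> ?C. y \<bullet> (A *\<^sub>v x) = 0})" .
  have "A\<^sup>T \<in> carrier_mat n n" using A by simp
  from count[OF this, unfolded sums count[OF A]]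
  have "?q ^ n * (?q - 1) * card (mat_kernel A) = ?q ^ n * (?q - 1) * card (mat_kernel A\<^sup>T)"
    by (rule add_left_imp_eq)
  then show ?thesis using q by simp
qed

lemma zero_mat_mult_vec:
  fixes w :: "'a::semiring_0 vec"
  shows "w \<in> carrier_vec n \<Longrightarrow> 0\<^sub>m m n *\<^sub>v w = 0\<^sub>v m"
  by (intro eq_vecI) (auto simp: scalar_prod_def)

section \<open>Adding a last row and column\<close>

definition vec_snoc :: "'a vec \<Rightarrow> 'a \<Rightarrow> 'a vec" where
  "vec_snoc v x = v @\<^sub>v vec 1 (\<lambda>_. x)"

lemma dim_vec_snoc [simp]: "dim_vec (vec_snoc v x) = Suc (dim_vec v)"
  by (simp add: vec_snoc_def)

lemma index_vec_snoc [simp]: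
  "i < dim_vec v \<Longrightarrow> vec_snoc v x $ i = v $ i"
  "i = dim_vec v \<Longrightarrow> vec_snoc v x $ i = x"
  by (simp_all add: vec_snoc_def)

lemma vec_snoc_carrier [simp]: "v \<in> carrier_vec n \<Longrightarrow> vec_snoc v x \<in> carrier_vec (Suc n)"
  by (intro carrier_vecI) simp

lemma vec_snoc_inject:
  assumes "v \<in> carrier_vec n" "w \<in> carrier_vec n"
  shows "vec_snoc v x = vec_snoc w y \<longleftrightarrow> v = w \<and> x = y"
  unfolding vec_snoc_def append_vec_eq[OF assms] by (auto simp: vec_eq_iff)

lemma vec_snoc_exhaust:
  assumes "u \<in> carrier_vec (Suc n)"
  obtains v x where "v \<in> carrier_vec n" "u = vec_snoc v x"
proof
  show "vec n (\<lambda>i. u $ i) \<in> carrier_vec n" by simp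
  show "u = vec_snoc (vec n (\<lambda>i. u $ i)) (u $ n)"
    using assms by (intro eq_vecI) (auto simp: less_Suc_eq)
qed

lemma scalar_prod_vec_snoc:
  fixes v w :: "'a::comm_semiring_0 vec"
  assumes "v \<in> carrier_vec n" "w \<in> carrier_vec n"
  shows "vec_snoc v x \<bullet> vec_snoc w y = v \<bullet> w + x * y"
  unfolding vec_snoc_def using assms
  by (subst scalar_prod_append[of _ n _ 1]) (auto simp: scalar_prod_def)

lemma vec_snoc_eq_zero_iff:
  "v \<in> carrier_vec n \<Longrightarrow> vec_snoc v x = 0\<^sub>v (Suc n) \<longleftrightarrow> v = 0\<^sub>v n \<and> x = 0"
proof -
  assume v: "v \<in> carrier_vec n"
  have "0\<^sub>v (Suc n) = vec_snoc (0\<^sub>v n) (0 :: 'a)"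
    by (intro eq_vecI) (auto simp: less_Suc_eq)
  then show ?thesis using vec_snoc_inject[OF v zero_carrier_vec] by simp
qed

definition border :: "'a::zero mat \<Rightarrow> 'a vec \<Rightarrow> 'a \<Rightarrow> 'a mat" where
  "border Y v x = (let n = dim_row Y in
     mat (Suc n) (Suc n) (\<lambda>(i, j).
       if j < n then (if i < n then Y $$ (i, j) else 0) else (if i < n then v $ i else x)))"

lemma border_carrier [simp]: "Y \<in> carrier_mat n n \<Longrightarrow> border Y v x \<in> carrier_mat (Suc n) (Suc n)"
  by (auto simp: border_def Let_def)

lemma col_border:
  assumes "Y \<in> carrier_mat n n" "v \<in> carrier_vec n"
  shows "j < n \<Longrightarrow> col (border Y v x) j = vec_snoc (col Y j) 0"
    and "col (border Y v x) n = vec_snoc v x"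
  using assms by (auto simp: border_def Let_def less_Suc_eq intro!: eq_vecI)

lemma row_border:
  assumes "Y \<in> carrier_mat n n" "v \<in> carrier_vec n"
  shows "i < n \<Longrightarrow> row (border Y v x) i = vec_snoc (row Y i) (v $ i)"
    and "row (border Y v x) n = vec_snoc (0\<^sub>v n) x"
  using assms by (auto simp: border_def Let_def less_Suc_eq intro!: eq_vecI)

lemma border_mult_vec:
  fixes Y :: "'a::comm_semiring_0 mat"
  assumes Y: "Y \<in> carrier_mat n n" and v: "v \<in> carrier_vec n" and w: "w \<in> carrier_vec n"
  shows "border Y v x *\<^sub>v vec_snoc w t = vec_snoc (Y *\<^sub>v w + t \<cdot>\<^sub>v v) (x * t)"
proof
  have "dim_row (border Y v x) = Suc n" using border_carrier[OF Y] by auto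
  then show "dim_vec (border Y v x *\<^sub>v vec_snoc w t) = dim_vec (vec_snoc (Y *\<^sub>v w + t \<cdot>\<^sub>v v) (x * t))"
    using Y v by simp
  fix i assume "i < dim_vec (vec_snoc (Y *\<^sub>v w + t \<cdot>\<^sub>v v) (x * t))"
  then have "i < n \<or> i = n" using v by auto
  then show "(border Y v x *\<^sub>v vec_snoc w t) $ i = vec_snoc (Y *\<^sub>v w + t \<cdot>\<^sub>v v) (x * t) $ i"
    using Y v w \<open>dim_row (border Y v x) = Suc n\<close>
    by (auto simp: row_border scalar_prod_vec_snoc[of _ n] mult.commute)
qed

lemma border_inject:
  assumes "Y \<in> carrier_mat n n" "v \<in> carrier_vec n" "Z \<in> carrier_mat n n" "w \<in> carrier_vec n"
  shows "border Y v x = border Z w y \<longleftrightarrow> Y = Z \<and> v = w \<and> x = y"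
proof
  assume eq: "border Y v x = border Z w y"
  have "vec_snoc (col Y j) 0 = vec_snoc (col Z j) 0" if "j < n" for j
    using col_border(1)[OF assms(1,2) that] col_border(1)[OF assms(3,4) that] eq by metis
  then have "col Y j = col Z j" if "j < n" for j
    using that assms vec_snoc_inject[of "col Y j" n "col Z j"] by auto
  then have "Y = Z" using assms by (intro mat_col_eqI) auto
  moreover have "vec_snoc v x = vec_snoc w y"
    using col_border(2)[OF assms(1,2)] col_border(2)[OF assms(3,4)] eq by metis
  ultimately show "Y = Z \<and> v = w \<and> x = y" using assms by (simp add: vec_snoc_inject)
qed simp

lemma upper_triangular_border:
  assumes "Y \<in> carrier_mat n n"
  shows "upper_triangular (border Y v x) \<longleftrightarrow> upper_triangular Y"
  using assms by (auto simp: upper_triangular_def border_def Let_def less_Suc_eq)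

lemma upper_triangular_border_exhaust:
  assumes "X \<in> carrier_mat (Suc n) (Suc n)" "upper_triangular X"
  obtains Y v x where "Y \<in> carrier_mat n n" "v \<in> carrier_vec n" "X = border Y v x"
proof
  show "mat n n (\<lambda>ij. X $$ ij) \<in> carrier_mat n n" "vec n (\<lambda>i. X $$ (i, n)) \<in> carrier_vec n"
    by auto
  show "X = border (mat n n (\<lambda>ij. X $$ ij)) (vec n (\<lambda>i. X $$ (i, n))) (X $$ (n, n))"
    using assms by (intro eq_matI) (auto simp: border_def Let_def less_Suc_eq)
qed

text \<open>
  The column space of the bordered matrix consists of the vectors \<open>(u + t v, x t)\<close> with u in the
  column space C of Y. If v is in C (so x = 0) this is a copy of C. Otherwise \<open>(u, t)\<close> is
  determined by \<open>u + t v\<close>, and there are q times as many vectors as in C.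
\<close>

lemma rank_border:
  fixes Y :: "'a::{field,finite} mat"
  assumes Y: "Y \<in> carrier_mat n n" and v: "v \<in> carrier_vec n"
    and corner: "v \<in> vec_space.col_space n Y \<Longrightarrow> x = 0"
  shows "vec_space.rank (Suc n) (border Y v x)
           = vec_space.rank n Y + (if v \<in> vec_space.col_space n Y then 0 else 1)"
proof -
  let ?C = "vec_space.col_space n Y" and ?B = "border Y v x"
  have C: "?C = (\<lambda>w. Y *\<^sub>v w) ` carrier_vec n" using col_space_eq_image[OF Y] .
  have Csub: "?C \<subseteq> carrier_vec n" using Y by (auto simp: C)
  have lin: "u + c \<cdot>\<^sub>v u' \<in> ?C" if uu: "u \<in> ?C" "u' \<in> ?C" for u u' c
  proof -
    obtain w w' where "w \<in> carrier_vec n" "w' \<in> carrier_vec n" "u = Y *\<^sub>v w" "u' = Y *\<^sub>v w'"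
      using uu by (auto simp: C)
    then have "u + c \<cdot>\<^sub>v u' = Y *\<^sub>v (w + c \<cdot>\<^sub>v w')"
      using Y by (simp add: mult_add_distrib_mat_vec[of _ n n] mult_mat_vec[of _ n n])
    then show ?thesis using \<open>w \<in> carrier_vec n\<close> \<open>w' \<in> carrier_vec n\<close> by (auto simp: C)
  qed
  have CB: "vec_space.col_space (Suc n) ?B = (\<lambda>(u, t). vec_snoc (u + t \<cdot>\<^sub>v v) (x * t)) ` (?C \<times> UNIV)"
    (is "?L = ?R")
  proof
    show "?L \<subseteq> ?R"
    proof
      fix b assume "b \<in> ?L"
      then obtain w' where w': "w' \<in> carrier_vec (Suc n)" "b = ?B *\<^sub>v w'"
        using col_space_eq_image[OF border_carrier[OF Y]] by auto
      obtain w t where "w \<in> carrier_vec n" "w' = vec_snoc w t"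
        using vec_snoc_exhaust[OF w'(1)] .
      then have "b = (\<lambda>(u, t). vec_snoc (u + t \<cdot>\<^sub>v v) (x * t)) (Y *\<^sub>v w, t)" "Y *\<^sub>v w \<in> ?C"
        using w'(2) by (simp_all add: border_mult_vec[OF Y v] C)
      then show "b \<in> ?R" by blast
    qed
    show "?R \<subseteq> ?L"
    proof clarify
      fix u t assume "u \<in> ?C"
      then obtain w where w: "w \<in> carrier_vec n" "u = Y *\<^sub>v w" by (auto simp: C)
      then have "vec_snoc (u + t \<cdot>\<^sub>v v) (x * t) = ?B *\<^sub>v vec_snoc w t"
        by (simp add: border_mult_vec[OF Y v])
      then show "vec_snoc (u + t \<cdot>\<^sub>v v) (x * t) \<in> ?L"
        using col_space_eq_image[OF border_carrier[OF Y]] w by auto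
    qed
  qed
  have "card (vec_space.col_space (Suc n) ?B) = card ?C * (if v \<in> ?C then 1 else CARD('a))"
  proof (cases "v \<in> ?C")
    case True
    have "?R = (\<lambda>u. vec_snoc u 0) ` ?C"
    proof
      show "?R \<subseteq> (\<lambda>u. vec_snoc u 0) ` ?C" using lin True corner by auto
      show "(\<lambda>u. vec_snoc u 0) ` ?C \<subseteq> ?R"
      proof clarify
        fix u assume u: "u \<in> ?C"
        have "u \<in> carrier_vec n" using u Csub by blast
        then have "u + 0 \<cdot>\<^sub>v v = u" using v by (intro eq_vecI) auto
        then have "vec_snoc u 0 = vec_snoc (u + 0 \<cdot>\<^sub>v v) (x * 0)" by simp
        then show "vec_snoc u 0 \<in> ?R" using u by force
      qed
    qed
    moreover have "inj_on (\<lambda>u. vec_snoc u (0 :: 'a)) ?C"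
      using Csub by (intro inj_onI) (meson subsetD vec_snoc_inject)
    ultimately show ?thesis using True CB by (simp add: card_image)
  next
    case False
    have "inj_on (\<lambda>(u, t). vec_snoc (u + t \<cdot>\<^sub>v v) (x * t)) (?C \<times> UNIV)"
    proof (rule inj_onI, clarify)
      fix u t u' t' assume u: "u \<in> ?C" "u' \<in> ?C"
        and "vec_snoc (u + t \<cdot>\<^sub>v v) (x * t) = vec_snoc (u' + t' \<cdot>\<^sub>v v) (x * t')"
      moreover have uc: "u \<in> carrier_vec n" "u' \<in> carrier_vec n" using u Csub by auto
      ultimately have eq: "u + t \<cdot>\<^sub>v v = u' + t' \<cdot>\<^sub>v v"
        using v by (subst (asm) vec_snoc_inject[of _ n]) auto
      have pt: "u $ i + t * v $ i = u' $ i + t' * v $ i" if "i < n" for i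
        using arg_cong[OF eq, of "\<lambda>z. z $ i"] uc v that by simp
      have "t = t'"
      proof (rule ccontr)
        assume t: "t \<noteq> t'"
        \<comment> \<open>Two representations with different t would express v through elements of C.\<close>
        have "v = 0\<^sub>v n + (1 / (t' - t)) \<cdot>\<^sub>v (u + (-1) \<cdot>\<^sub>v u')"
          using uc v t pt by (intro eq_vecI) (auto simp: field_simps)
        moreover have "0\<^sub>v n \<in> ?C" using Y by (auto simp: C intro!: image_eqI[of _ _ "0\<^sub>v n"])
        ultimately have "v \<in> ?C" using lin[OF \<open>0\<^sub>v n \<in> ?C\<close> lin[OF u(1) u(2)]] by metis
        then show False using False by simp
      qed
      then show "u = u' \<and> t = t'" using pt uc by (auto intro!: eq_vecI)
    qed
    then show ?thesis using False CB by (simp add: card_image card_cartesian_product)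
  qed
  then have "CARD('a) ^ vec_space.rank (Suc n) ?B
      = CARD('a) ^ (vec_space.rank n Y + (if v \<in> ?C then 0 else 1))"
    by (simp add: card_col_space[OF Y] card_col_space[OF border_carrier[OF Y]])
  then show ?thesis using one_less_card_field[where 'a = 'a] by (simp only: power_inject_exp)
qed

section \<open>The common recurrence\<close>

fun triangular_rank_count :: "int \<Rightarrow> nat \<Rightarrow> nat \<Rightarrow> int" where
  "triangular_rank_count q 0 r = (if r = 0 then 1 else 0)"
| "triangular_rank_count q (Suc n) 0 = triangular_rank_count q n 0"
| "triangular_rank_count q (Suc n) (Suc r) =
     q ^ Suc r * triangular_rank_count q n (Suc r)
     + (q ^ (n - r) - q ^ r) * triangular_rank_count q n r"

lemma triangular_rank_count_rank_0: "triangular_rank_count q n 0 = 1"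
  by (induction n) auto

text \<open>
  At the boundary n = 2 r of the step to n + 1 and r + 1, where the count for n and r need not
  vanish, its coefficient does.
\<close>

lemma triangular_rank_count_eq_0: "n < 2 * r \<Longrightarrow> triangular_rank_count q n r = 0"
proof (induction q n r rule: triangular_rank_count.induct)
  case (3 q n r)
  show ?case
  proof (cases "n = 2 * r")
    case True
    then show ?thesis using 3 by simp
  next
    case False
    then show ?thesis using 3 by simp
  qed
qed auto

text \<open>
  The features shared by the two families: the members of size n + 1 are the borders of the
  members Y of size n by the vectors of K Y, where K Y contains the column space of Y and has as
  many elements as the kernel of Y. The corner entry is a function of the last column that
  vanishes on the column space.
\<close>

locale bordered_family =
  fixes S :: "nat \<Rightarrow> 'a::{field,finite} mat set"
    and K :: "'a mat \<Rightarrow> 'a vec set"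
    and corner :: "'a vec \<Rightarrow> 'a"
  assumes S_0: "S 0 = {0\<^sub>m 0 0}"
    and S_Suc: "S (Suc n) = (\<lambda>(Y, v). border Y v (corner v)) ` (SIGMA Y:S n. K Y)"
    and S_carrier: "Y \<in> S n \<Longrightarrow> Y \<in> carrier_mat n n"
    and K_carrier: "Y \<in> S n \<Longrightarrow> K Y \<subseteq> carrier_vec n"
    and card_K: "Y \<in> S n \<Longrightarrow> card (K Y) = CARD('a) ^ (n - vec_space.rank n Y)"
    and col_space_subset_K: "Y \<in> S n \<Longrightarrow> vec_space.col_space n Y \<subseteq> K Y"
    and corner_col_space: "Y \<in> S n \<Longrightarrow> v \<in> vec_space.col_space n Y \<Longrightarrow> corner v = 0"
begin

text \<open>
  A matrix of rank r arises from a Y of rank r with last column in the column space, or from a Y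
  of rank r - 1 with last column in the rest of K Y.
\<close>

lemma card_of_rank_Suc:
  "int (card {X \<in> S (Suc n). vec_space.rank (Suc n) X = r})
     = int CARD('a) ^ r * int (card {Y \<in> S n. vec_space.rank n Y = r})
       + (\<Sum>Y | Y \<in> S n \<and> Suc (vec_space.rank n Y) = r.
            int CARD('a) ^ (n - vec_space.rank n Y) - int CARD('a) ^ vec_space.rank n Y)"
proof -
  let ?rk = "vec_space.rank n :: 'a mat \<Rightarrow> nat" and ?C = "vec_space.col_space n :: 'a mat \<Rightarrow> 'a vec set"
  let ?b = "\<lambda>(Y, v). border Y v (corner v)"
  define P where "P = (SIGMA Y:{Y \<in> S n. ?rk Y = r}. ?C Y)"
  define Q where "Q = (SIGMA Y:{Y \<in> S n. Suc (?rk Y) = r}. K Y - ?C Y)"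
  have PQ: "Y \<in> S n \<and> v \<in> K Y" if "(Y, v) \<in> P \<union> Q" for Y v
    using that col_space_subset_K[of Y n] unfolding P_def Q_def by blast
  have finS: "finite (S n)"
    by (rule finite_subset[OF _ finite_carrier_mat]) (use S_carrier in auto)
  have finK: "finite (K Y)" if "Y \<in> S n" for Y
    using K_carrier[OF that] finite_carrier_vec by (rule finite_subset)
  have finC: "finite (?C Y)" if "Y \<in> S n" for Y
    using col_space_subset_K[OF that] finK[OF that] by (rule finite_subset)
  have rk: "vec_space.rank (Suc n) (border Y v (corner v)) = ?rk Y + (if v \<in> ?C Y then 0 else 1)"
    if "Y \<in> S n" "v \<in> K Y" for Y v
    using K_carrier[OF that(1)] that(2)
    by (intro rank_border S_carrier[OF that(1)] corner_col_space[OF that(1)]) auto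
  have "{X \<in> S (Suc n). vec_space.rank (Suc n) X = r} = ?b ` (P \<union> Q)"
  proof
    show "{X \<in> S (Suc n). vec_space.rank (Suc n) X = r} \<subseteq> ?b ` (P \<union> Q)"
    proof
      fix X assume "X \<in> {X \<in> S (Suc n). vec_space.rank (Suc n) X = r}"
      then obtain Y v where Yv: "Y \<in> S n" "v \<in> K Y" "X = ?b (Y, v)" "vec_space.rank (Suc n) X = r"
        using S_Suc by auto
      have "(Y, v) \<in> P \<union> Q"
        using rk[OF Yv(1,2)] Yv by (auto simp: P_def Q_def split: if_splits)
      then show "X \<in> ?b ` (P \<union> Q)" using Yv(3) by blast
    qed
    show "?b ` (P \<union> Q) \<subseteq> {X \<in> S (Suc n). vec_space.rank (Suc n) X = r}"
    proof
      fix X assume "X \<in> ?b ` (P \<union> Q)"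
      then obtain Y v where Yv: "(Y, v) \<in> P \<union> Q" "X = ?b (Y, v)" by auto
      then have "Y \<in> S n" "v \<in> K Y" using PQ by auto
      then show "X \<in> {X \<in> S (Suc n). vec_space.rank (Suc n) X = r}"
        using Yv rk[of Y v] by (auto simp: S_Suc P_def Q_def)
    qed
  qed
  moreover have "inj_on ?b (P \<union> Q)"
  proof (rule inj_onI, clarify)
    fix Y v Z w assume "(Y, v) \<in> P \<union> Q" "(Z, w) \<in> P \<union> Q"
      and eq: "border Y v (corner v) = border Z w (corner w)"
    then have Y: "Y \<in> S n" "v \<in> K Y" and Z: "Z \<in> S n" "w \<in> K Z"
      using PQ by auto
    have "v \<in> carrier_vec n" "w \<in> carrier_vec n" using Y Z K_carrier by auto
    from border_inject[OF S_carrier[OF Y(1)] this(1) S_carrier[OF Z(1)] this(2)] eq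
    show "Y = Z \<and> v = w" by simp
  qed
  moreover have "P \<inter> Q = {}" "finite P" "finite Q"
    using finS finK finC by (auto simp: P_def Q_def)
  ultimately have "card {X \<in> S (Suc n). vec_space.rank (Suc n) X = r} = card P + card Q"
    by (simp add: card_image card_Un_disjoint)
  moreover have "card P = CARD('a) ^ r * card {Y \<in> S n. ?rk Y = r}"
  proof -
    have "card P = (\<Sum>Y | Y \<in> S n \<and> ?rk Y = r. card (?C Y))"
      unfolding P_def using finS finC by (intro card_SigmaI) auto
    also have "\<dots> = (\<Sum>Y | Y \<in> S n \<and> ?rk Y = r. CARD('a) ^ r)"
    proof (rule sum.cong[OF refl], clarify)
      fix Y assume "Y \<in> S n"
      then show "card (?C Y) = CARD('a) ^ ?rk Y" using S_carrier card_col_space by blast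
    qed
    finally show ?thesis by simp
  qed
  moreover have "int (card Q) = (\<Sum>Y | Y \<in> S n \<and> Suc (?rk Y) = r.
            int CARD('a) ^ (n - ?rk Y) - int CARD('a) ^ ?rk Y)"
  proof -
    have "card Q = (\<Sum>Y | Y \<in> S n \<and> Suc (?rk Y) = r. card (K Y - ?C Y))"
      unfolding Q_def using finS finK by (intro card_SigmaI) auto
    also have "int \<dots> = (\<Sum>Y | Y \<in> S n \<and> Suc (?rk Y) = r.
            int CARD('a) ^ (n - ?rk Y) - int CARD('a) ^ ?rk Y)"
      unfolding of_nat_sum
    proof (rule sum.cong[OF refl], clarify)
      fix Y assume Y: "Y \<in> S n"
      have "int (card (K Y - ?C Y)) = int (card (K Y)) - int (card (?C Y))"
        using finK[OF Y] finC[OF Y] col_space_subset_K[OF Y]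
        by (simp add: card_Diff_subset card_mono of_nat_diff)
      then show "int (card (K Y - ?C Y)) = int CARD('a) ^ (n - ?rk Y) - int CARD('a) ^ ?rk Y"
        using card_K[OF Y] card_col_space[OF S_carrier[OF Y]] by simp
    qed
    finally show ?thesis .
  qed
  ultimately show ?thesis by simp
qed

lemma card_of_rank:
  "int (card {X \<in> S n. vec_space.rank n X = r}) = triangular_rank_count (int CARD('a)) n r"
proof (induction "int CARD('a)" n r rule: triangular_rank_count.induct)
  case (1 r)
  have "vec_space.rank 0 (0\<^sub>m 0 0 :: 'a mat) = 0" using rank_le_dim[of "0\<^sub>m 0 0 :: 'a mat" 0] by simp
  then have "{X \<in> S 0. vec_space.rank 0 X = r} = (if r = 0 then {0\<^sub>m 0 0} else {})"
    by (auto simp: S_0)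
  then show ?case by simp
next
  case (2 n)
  then show ?case by (simp add: card_of_rank_Suc)
next
  case (3 n r)
  have "(\<Sum>Y | Y \<in> S n \<and> Suc (vec_space.rank n Y) = Suc r.
            int CARD('a) ^ (n - vec_space.rank n Y) - int CARD('a) ^ vec_space.rank n Y)
      = (\<Sum>Y | Y \<in> S n \<and> vec_space.rank n Y = r. int CARD('a) ^ (n - r) - int CARD('a) ^ r)"
    by (rule sum.cong) auto
  then show ?case using 3 by (simp add: card_of_rank_Suc)
qed

end

section \<open>Square-zero matrices\<close>

lemma square_zero_iff:
  fixes X :: "'a::comm_ring_1 mat"
  assumes X: "X \<in> carrier_mat n n"
  shows "X * X = 0\<^sub>m n n \<longleftrightarrow> (\<forall>j<n. X *\<^sub>v col X j = 0\<^sub>v n)"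
proof
  assume "X * X = 0\<^sub>m n n"
  then show "\<forall>j<n. X *\<^sub>v col X j = 0\<^sub>v n" using X by (metis col_mult2 col_zero)
next
  assume r: "\<forall>j<n. X *\<^sub>v col X j = 0\<^sub>v n"
  show "X * X = 0\<^sub>m n n"
  proof (rule mat_col_eqI)
    fix j assume "j < dim_col (0\<^sub>m n n :: 'a mat)"
    then have j: "j < n" by simp
    show "col (X * X) j = col (0\<^sub>m n n) j"
      unfolding col_mult2[OF X X j] col_zero[OF j] using r j by blast
  qed (use X in auto)
qed

lemma square_zero_border:
  fixes Y :: "'a::field mat"
  assumes Y: "Y \<in> carrier_mat n n" and v: "v \<in> carrier_vec n"
  shows "border Y v x * border Y v x = 0\<^sub>m (Suc n) (Suc n)
    \<longleftrightarrow> Y * Y = 0\<^sub>m n n \<and> v \<in> mat_kernel Y \<and> x = 0"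
proof -
  have "border Y v x * border Y v x = 0\<^sub>m (Suc n) (Suc n) \<longleftrightarrow>
      (\<forall>j<n. Y *\<^sub>v col Y j + 0 \<cdot>\<^sub>v v = 0\<^sub>v n) \<and> Y *\<^sub>v v + x \<cdot>\<^sub>v v = 0\<^sub>v n \<and> x * x = 0"
    unfolding square_zero_iff[OF border_carrier[OF Y]] All_less_Suc
    using Y v by (auto simp: col_border border_mult_vec vec_snoc_eq_zero_iff)
  moreover have "Y *\<^sub>v col Y j + 0 \<cdot>\<^sub>v v = Y *\<^sub>v col Y j" if "j < n" for j
    using Y v by (intro eq_vecI) auto
  moreover have "Y *\<^sub>v v + 0 \<cdot>\<^sub>v v = Y *\<^sub>v v"
    using Y v by (intro eq_vecI) auto
  ultimately show ?thesis
    unfolding square_zero_iff[OF Y] using Y v by (auto simp: mat_kernel_def)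
qed

lemma square_zero_count_eq:
  "int (square_zero_count TYPE('a::{field,finite}) n r)
     = triangular_rank_count (int CARD('a)) n r"
proof -
  let ?S = "\<lambda>n. {X :: 'a mat. X \<in> carrier_mat n n \<and> upper_triangular X \<and> X * X = 0\<^sub>m n n}"
  interpret bordered_family ?S mat_kernel "\<lambda>_. 0"
  proof
    show "?S 0 = {0\<^sub>m 0 0}" by (auto simp: carrier_mat_0)
    show "?S (Suc n) = (\<lambda>(Y, v). border Y v 0) ` (SIGMA Y:?S n. mat_kernel Y)" for n
    proof
      show "?S (Suc n) \<subseteq> (\<lambda>(Y, v). border Y v 0) ` (SIGMA Y:?S n. mat_kernel Y)"
      proof clarify
        fix X :: "'a mat"
        assume X: "X \<in> carrier_mat (Suc n) (Suc n)" "upper_triangular X"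
          "X * X = 0\<^sub>m (Suc n) (Suc n)"
        obtain Y v x where Y: "Y \<in> carrier_mat n n" "v \<in> carrier_vec n" "X = border Y v x"
          using upper_triangular_border_exhaust[OF X(1,2)] .
        then have "X = (\<lambda>(Y, v). border Y v 0) (Y, v)" "(Y, v) \<in> (SIGMA Y:?S n. mat_kernel Y)"
          using X(2,3) by (simp_all add: square_zero_border upper_triangular_border)
        then show "X \<in> (\<lambda>(Y, v). border Y v 0) ` (SIGMA Y:?S n. mat_kernel Y)" by blast
      qed
      show "(\<lambda>(Y, v). border Y v 0) ` (SIGMA Y:?S n. mat_kernel Y) \<subseteq> ?S (Suc n)"
        by (auto simp: square_zero_border upper_triangular_border mat_kernel_def)
    qed
  next
    fix Y n assume "Y \<in> ?S n"
    then have Y: "Y \<in> carrier_mat n n" and sq: "Y * Y = 0\<^sub>m n n" by auto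
    show "Y \<in> carrier_mat n n" by fact
    show "mat_kernel Y \<subseteq> carrier_vec n" using Y by (auto simp: mat_kernel_def)
    show "card (mat_kernel Y) = CARD('a) ^ (n - vec_space.rank n Y)" using card_kernel[OF Y] .
    show "vec_space.col_space n Y \<subseteq> mat_kernel Y"
    proof -
      have "Y *\<^sub>v (Y *\<^sub>v w) = 0\<^sub>v n" if "w \<in> carrier_vec n" for w
        using assoc_mult_mat_vec[OF Y Y that] sq zero_mat_mult_vec[OF that] by simp
      then show ?thesis using Y by (auto simp: col_space_eq_image[OF Y] mat_kernel_def)
    qed
  qed simp
  show ?thesis
    unfolding square_zero_count_def card_of_rank[symmetric] by (simp add: conj_assoc)
qed

section \<open>Matrices with isotropic column space in characteristic two\<close>

lemma sum_squares_eq_square_sum_char_2: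
  fixes f :: "'b \<Rightarrow> 'a::comm_ring_1"
  assumes "(2 :: 'a) = 0"
  shows "(\<Sum>i\<in>A. f i * f i) = sum f A * sum f A"
proof (induction A rule: infinite_finite_induct)
  case (insert a A)
  have "(f a + sum f A) * (f a + sum f A) = f a * f a + sum f A * sum f A + 2 * (f a * sum f A)"
    by (simp add: algebra_simps)
  then show ?case using insert assms by simp
qed auto

lemma gram_zero_iff:
  fixes U :: "'a::comm_ring_1 mat"
  assumes "U \<in> carrier_mat n n"
  shows "U\<^sup>T * U = 0\<^sub>m n n \<longleftrightarrow> (\<forall>i<n. \<forall>j<n. col U i \<bullet> col U j = 0)"
  using assms by (auto simp: mat_eq_iff)

lemma gram_zero_border:
  fixes V :: "'a::comm_ring_1 mat"
  assumes V: "V \<in> carrier_mat n n" and v: "v \<in> carrier_vec n"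
  shows "(border V v x)\<^sup>T * border V v x = 0\<^sub>m (Suc n) (Suc n)
    \<longleftrightarrow> V\<^sup>T * V = 0\<^sub>m n n \<and> v \<in> mat_kernel V\<^sup>T \<and> v \<bullet> v + x * x = 0"
proof -
  have col: "col V j \<in> carrier_vec n" if "j < n" for j using V that by auto
  have "v \<in> mat_kernel V\<^sup>T \<longleftrightarrow> (\<forall>j<n. col V j \<bullet> v = 0)"
    using V v by (auto simp: mat_kernel_def vec_eq_iff)
  moreover have "v \<bullet> col V j = col V j \<bullet> v" if "j < n" for j
    using comm_scalar_prod[OF v col[OF that]] .
  ultimately show ?thesis
    unfolding gram_zero_iff[OF border_carrier[OF V]] gram_zero_iff[OF V] All_less_Suc
    using V v col by (auto simp: col_border scalar_prod_vec_snoc[of _ n])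
qed

lemma gram_zero_count_eq:
  assumes two: "(2 :: 'a::{field,finite}) = 0"
  shows "int (gram_zero_count TYPE('a) n r) = triangular_rank_count (int CARD('a)) n r"
proof -
  let ?S = "\<lambda>n. {U :: 'a mat. U \<in> carrier_mat n n \<and> upper_triangular U \<and> U\<^sup>T * U = 0\<^sub>m n n}"
  define \<sigma> :: "'a vec \<Rightarrow> 'a" where "\<sigma> v = (\<Sum>i<dim_vec v. v $ i)" for v
  have norm: "v \<bullet> v = \<sigma> v * \<sigma> v" for v :: "'a vec"
    using sum_squares_eq_square_sum_char_2[OF two, of "\<lambda>i. v $ i"]
    by (simp add: scalar_prod_def \<sigma>_def atLeast0LessThan)
  have corner: "v \<bullet> v + x * x = 0 \<longleftrightarrow> x = \<sigma> v" for v x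
  proof -
    have "(\<sigma> v - x) * (\<sigma> v - x) = v \<bullet> v + x * x - 2 * (\<sigma> v * x)"
      by (simp add: norm algebra_simps)
    then have "v \<bullet> v + x * x = (\<sigma> v - x) * (\<sigma> v - x)" using two by simp
    then show ?thesis by auto
  qed
  interpret bordered_family ?S "\<lambda>V. mat_kernel V\<^sup>T" \<sigma>
  proof
    show "?S 0 = {0\<^sub>m 0 0}" by (auto simp: carrier_mat_0)
    show "?S (Suc n) = (\<lambda>(V, v). border V v (\<sigma> v)) ` (SIGMA V:?S n. mat_kernel V\<^sup>T)" for n
    proof
      show "?S (Suc n) \<subseteq> (\<lambda>(V, v). border V v (\<sigma> v)) ` (SIGMA V:?S n. mat_kernel V\<^sup>T)"
      proof clarify
        fix U :: "'a mat"
        assume U: "U \<in> carrier_mat (Suc n) (Suc n)" "upper_triangular U"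
          "U\<^sup>T * U = 0\<^sub>m (Suc n) (Suc n)"
        obtain V v x where V: "V \<in> carrier_mat n n" "v \<in> carrier_vec n" "U = border V v x"
          using upper_triangular_border_exhaust[OF U(1,2)] .
        then have "U = (\<lambda>(V, v). border V v (\<sigma> v)) (V, v)" "(V, v) \<in> (SIGMA V:?S n. mat_kernel V\<^sup>T)"
          using U(2,3) by (simp_all add: gram_zero_border corner upper_triangular_border)
        then show "U \<in> (\<lambda>(V, v). border V v (\<sigma> v)) ` (SIGMA V:?S n. mat_kernel V\<^sup>T)" by blast
      qed
      show "(\<lambda>(V, v). border V v (\<sigma> v)) ` (SIGMA V:?S n. mat_kernel V\<^sup>T) \<subseteq> ?S (Suc n)"
        by (auto simp: gram_zero_border corner upper_triangular_border mat_kernel_def)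
    qed
  next
    fix V n assume "V \<in> ?S n"
    then have V: "V \<in> carrier_mat n n" and gram: "V\<^sup>T * V = 0\<^sub>m n n" by auto
    have VT: "V\<^sup>T \<in> carrier_mat n n" using V by simp
    have iso: "V\<^sup>T *\<^sub>v (V *\<^sub>v w) = 0\<^sub>v n" if "w \<in> carrier_vec n" for w
      using assoc_mult_mat_vec[OF VT V that] gram zero_mat_mult_vec[OF that] by simp
    show "V \<in> carrier_mat n n" by fact
    show "mat_kernel V\<^sup>T \<subseteq> carrier_vec n" using V by (auto simp: mat_kernel_def)
    show "card (mat_kernel V\<^sup>T) = CARD('a) ^ (n - vec_space.rank n V)"
      using card_kernel[OF V] card_kernel_transpose[OF V] by simp
    show "vec_space.col_space n V \<subseteq> mat_kernel V\<^sup>T"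
      using V iso by (auto simp: col_space_eq_image[OF V] mat_kernel_def)
    \<comment> \<open>The column space is totally isotropic, and \<sigma> v is the square root of \<open>v \<bullet> v\<close>.\<close>
    show "\<sigma> v = 0" if vC: "v \<in> vec_space.col_space n V" for v
    proof -
      obtain w where w: "w \<in> carrier_vec n" "v = V *\<^sub>v w"
        using vC by (auto simp: col_space_eq_image[OF V])
      have "v \<bullet> v = (V\<^sup>T *\<^sub>v v) \<bullet> w"
        using transpose_vec_mult_scalar[OF V w(1), of v] w V by simp
      also have "\<dots> = 0" using iso[OF w(1)] w by simp
      finally show ?thesis by (simp add: norm)
    qed
  qed
  show ?thesis
    unfolding gram_zero_count_def card_of_rank[symmetric] by (simp add: conj_assoc)
qed

theorem theorem6p2:
  fixes q e :: nat
  assumes "e \<ge> 1" and "q = 2 ^ e" and "card (UNIV :: 'a::{field,finite} set) = q"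
  shows "(\<forall>n. gram_zero_count TYPE('a) n 0 = 1
            \<and> (\<forall>r. r > n div 2 \<longrightarrow> gram_zero_count TYPE('a) n r = 0)
            \<and> (\<forall>r. 1 \<le> r \<and> r \<le> n div 2 \<longrightarrow>
                  int (gram_zero_count TYPE('a) n r)
                    = int q ^ r * int (gram_zero_count TYPE('a) (n - 1) r)
                      + (int q ^ (n - r) - int q ^ (r - 1))
                        * int (gram_zero_count TYPE('a) (n - 1) (r - 1))))
         \<and> (\<forall>n r. square_zero_count TYPE('a) n r = gram_zero_count TYPE('a) n r)"
proof -
  \<comment> \<open>The characteristic is a prime dividing the number of elements of the field, so it is 2.\<close>
  have "CHAR('a) dvd 2 ^ e" using CHAR_dvd_CARD[where 'a = 'a] assms by simp
  moreover have "prime CHAR('a)"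
    by (intro prime_CHAR_semidom finite_imp_CHAR_pos) simp
  ultimately have "CHAR('a) dvd 2" using prime_dvd_power by blast
  then have two: "(2 :: 'a) = 0" using of_nat_eq_0_iff_char_dvd[of 2, where 'a = 'a] by simp
  have gram: "int (gram_zero_count TYPE('a) n r) = triangular_rank_count (int q) n r" for n r
    using gram_zero_count_eq[OF two] assms(3) by simp
  have square: "int (square_zero_count TYPE('a) n r) = triangular_rank_count (int q) n r" for n r
    using square_zero_count_eq[where 'a = 'a] assms(3) by simp
  have "gram_zero_count TYPE('a) n 0 = 1" for n
    using gram[of n 0] by (simp add: triangular_rank_count_rank_0)
  moreover have "gram_zero_count TYPE('a) n r = 0" if "r > n div 2" for n r
    using gram[of n r] triangular_rank_count_eq_0[of n r "int q"] that by simp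
  moreover have "int (gram_zero_count TYPE('a) n r)
                    = int q ^ r * int (gram_zero_count TYPE('a) (n - 1) r)
                      + (int q ^ (n - r) - int q ^ (r - 1))
                        * int (gram_zero_count TYPE('a) (n - 1) (r - 1))"
    if "1 \<le> r \<and> r \<le> n div 2" for n r
  proof -
    have "n \<noteq> 0" "r \<noteq> 0" using that by auto
    then obtain m s where "n = Suc m" "r = Suc s" using not0_implies_Suc by blast
    then show ?thesis by (simp add: gram)
  qed
  moreover have "square_zero_count TYPE('a) n r = gram_zero_count TYPE('a) n r" for n r
    using gram[of n r] square[of n r] by simp
  ultimately show ?thesis by blast
qed

end
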